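(* Let $\mathcal{G}$ be any subgroup of $GL_2(\mathbb{Z})$. Then $\mathcal{G}$ is a maximal abelian subgroup of $GL_2(\mathbb{Z})$ if and only if $\mathcal{G}=\mathcal{S}(Q)$ for some form $Q\in\mathcal{F}_+\cup\mathcal{F}_-$.
   Context: Here a form is $Q(x,y)=ax^2+bxy+cy^2$ with $a,b,c$ coprime integers (not necessarily irreducible or indefinite), identified with the matrix $Q=\begin{pmatrix}a&b/2\\ b/2&c\end{pmatrix}$; its discriminant is $b^2-4ac$. $\mathcal{S}(Q)=\{M\in GL_2(\mathbb{Z}):\det(M)M^{T}QM=Q\}$. $\mathcal{F}_+$ is the set of forms that are indefinite and irreducible over $\mathbb{Q}$; $\mathcal{F}_-$ is the set of forms whose discriminant lies in $\{-4,-3,0,1,4\}$. *)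

theory Defs
  imports
    "HOL-Analysis.Analysis"
    "HOL-Computational_Algebra.Polynomial_Factorial"
    "HOL-Algebra.Group"
begin

definition GL2Z :: "(int^2^2) monoid" where
  "GL2Z = \<lparr>carrier = {M. invertible M}, mult = (**), one = mat 1\<rparr>"

lemma group_GL2Z: "group GL2Z"
proof (rule groupI)
  fix M assume "M \<in> carrier GL2Z"
  then obtain N where "M ** N = mat 1" "N ** M = mat 1"
    unfolding GL2Z_def invertible_def by auto
  then have "N \<in> carrier GL2Z" "N \<otimes>\<^bsub>GL2Z\<^esub> M = \<one>\<^bsub>GL2Z\<^esub>"
    unfolding GL2Z_def invertible_def by auto
  then show "\<exists>N\<in>carrier GL2Z. N \<otimes>\<^bsub>GL2Z\<^esub> M = \<one>\<^bsub>GL2Z\<^esub>" by blast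
qed (auto simp: GL2Z_def invertible_mult matrix_mul_assoc
       intro!: exI[of _ "mat 1"] simp: invertible_def[of "mat 1"])

definition maximal_abelian_subgroup :: "'a set \<Rightarrow> ('a, 'b) monoid_scheme \<Rightarrow> bool" where
  "maximal_abelian_subgroup H G \<longleftrightarrow>
     subgroup H G \<and> comm_group (G\<lparr>carrier := H\<rparr>) \<and>
     (\<forall>K. subgroup K G \<and> comm_group (G\<lparr>carrier := K\<rparr>) \<and> H \<subseteq> K \<longrightarrow> K = H)"

text \<open>The triple \<open>(a, b, c)\<close> stands for \<open>a x\<^sup>2 + b x y + c y\<^sup>2\<close>; coprimality of the
  coefficients is joint, not pairwise.\<close>

definition forms :: "(int \<times> int \<times> int) set" where
  "forms = {(a, b, c). gcd a (gcd b c) = 1}"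

fun form_eval :: "int \<times> int \<times> int \<Rightarrow> real \<Rightarrow> real \<Rightarrow> real" where
  "form_eval (a, b, c) x y =
     of_int a * x\<^sup>2 + of_int b * x * y + of_int c * y\<^sup>2"

fun form_matrix :: "int \<times> int \<times> int \<Rightarrow> real^2^2" where
  "form_matrix (a, b, c) =
     vector [vector [of_int a, of_int b / 2],
             vector [of_int b / 2, of_int c]]"

fun form_discr :: "int \<times> int \<times> int \<Rightarrow> int" where
  "form_discr (a, b, c) = b\<^sup>2 - 4 * a * c"

text \<open>The form as an element of \<open>\<rat>[y][x]\<close>: the outer variable is \<open>x\<close>, the inner one \<open>y\<close>.\<close>

fun form_poly :: "int \<times> int \<times> int \<Rightarrow> rat poly poly" where
  "form_poly (a, b, c) = [: [:0, 0, of_int c:], [:0, of_int b:], [:of_int a:] :]"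

lemma form_matrix_eval:
  "vector [x, y] \<bullet> (form_matrix Q *v vector [x, y]) = form_eval Q x y"
  by (cases Q) (simp add: inner_vec_def matrix_vector_mult_def sum_2 power2_eq_square
      algebra_simps)

lemma form_poly_eval:
  "poly (poly (form_poly (a, b, c)) [:x:]) y =
     of_int a * x\<^sup>2 + of_int b * x * y + of_int c * y\<^sup>2"
  by (simp add: power2_eq_square algebra_simps)

definition indefinite_form :: "int \<times> int \<times> int \<Rightarrow> bool" where
  "indefinite_form Q \<longleftrightarrow> (\<exists>x y. form_eval Q x y > 0) \<and> (\<exists>x y. form_eval Q x y < 0)"

definition S_group :: "int \<times> int \<times> int \<Rightarrow> (int^2^2) set" where
  "S_group Q = {M \<in> carrier GL2Z.
     real_of_int (det M) *\<^sub>R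
       (transpose (map_matrix real_of_int M) ** form_matrix Q ** map_matrix real_of_int M)
     = form_matrix Q}"

definition F_plus :: "(int \<times> int \<times> int) set" where
  "F_plus = {Q \<in> forms. indefinite_form Q \<and> irreducible (form_poly Q)}"

definition F_minus :: "(int \<times> int \<times> int) set" where
  "F_minus = {Q \<in> forms. form_discr Q \<in> {-4, -3, 0, 1, 4}}"

end

theory Submission
  imports Defs
begin

text \<open>
  Two integral \<open>2 \<times> 2\<close> matrices commute iff the forms \<open>M\<^sub>2\<^sub>1 x\<^sup>2 + (M\<^sub>2\<^sub>2 - M\<^sub>1\<^sub>1) x y - M\<^sub>1\<^sub>2 y\<^sup>2\<close>
  attached to them are proportional, and \<open>\<S>(Q)\<close> consists of the units whose form is an integral
  multiple \<open>t Q\<close>. Hence \<open>\<S>(Q)\<close> is always abelian, every maximal abelian subgroup is of this kind, and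
  \<open>\<S>(Q)\<close> is maximal as soon as it contains a non-scalar matrix. A matrix with form \<open>t Q\<close> and trace \<open>u\<close>
  has determinant \<open>(u\<^sup>2 - D t\<^sup>2) / 4\<close>, where \<open>D\<close> is the discriminant of \<open>Q\<close>, so the question is
  for which \<open>D\<close> the equation \<open>u\<^sup>2 - D t\<^sup>2 = \<plusminus>4\<close> has a solution with \<open>t \<noteq> 0\<close>: for every positive
  non-square by Pell's equation, and otherwise only for \<open>-4, -3, 0, 1, 4\<close>.
\<close>

section \<open>Pell's equation\<close>

lemma square_int_if_rational_square:
  fixes p q D :: int
  assumes "p\<^sup>2 = D * q\<^sup>2" "q \<noteq> 0"
  shows "\<exists>d. D = d\<^sup>2"
proof -
  have "q\<^sup>2 dvd p\<^sup>2" using assms by simp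
  then have "q dvd p" by simp
  then obtain k where "p = q * k" ..
  with assms have "D = k\<^sup>2" by (simp add: power_mult_distrib)
  then show ?thesis ..
qed

lemma sqrt_int_not_rational:
  fixes D :: int
  assumes "D > 0" "\<nexists>d. D = d\<^sup>2"
  shows "sqrt (of_int D) \<notin> \<rat>"
proof
  assume "sqrt (of_int D) \<in> \<rat>"
  then obtain p q where q: "q > 0" and eq: "sqrt (of_int D) = of_int p / of_int q"
    by (meson Rats_cases')
  have "real_of_int D = (of_int p / of_int q)\<^sup>2"
    using assms(1) by (simp flip: eq)
  then have "real_of_int (p\<^sup>2) = of_int (D * q\<^sup>2)"
    using q by (simp add: field_simps)
  then have "p\<^sup>2 = D * q\<^sup>2" by (simp only: of_int_eq_iff)
  with square_int_if_rational_square q assms(2) show False by fastforce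
qed

text \<open>For \<open>e = h - k sqrt D\<close> the norm factors as
  \<open>e (e + 2 k sqrt D)\<close>. Dirichlet's inequality gives
  \<open>\<bar>e\<bar> k \<le> 1\<close>, so the bound is independent of \<open>h\<close> and
  \<open>k\<close>.\<close>

lemma approx_set_sqrt_norm_bound:
  fixes D :: int
  assumes D: "D > 0" and hk: "(h, k) \<in> approx_set (sqrt (of_int D))"
  shows "\<bar>h\<^sup>2 - D * k\<^sup>2\<bar> \<le> 2 * D + 1"
proof -
  let ?s = "sqrt (of_int D)"
  have k: "k > 0" and a: "\<bar>?s - of_int h / of_int k\<bar> < 1 / (of_int k)\<^sup>2"
    using hk by (auto simp: approx_set_def)
  have k1: "real_of_int k \<ge> 1" using k by simp
  have s1: "?s \<ge> 1" using D by simp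
  have ss: "?s * ?s = of_int D" using D by simp
  have sD: "?s \<le> of_int D" using s1 ss mult_left_mono[of 1 ?s ?s] by linarith
  define e where "e = of_int h - of_int k * ?s"
  have "\<bar>e\<bar> = of_int k * \<bar>?s - of_int h / of_int k\<bar>"
    using k by (simp add: e_def abs_if field_simps)
  also have "\<dots> < of_int k * (1 / (of_int k)\<^sup>2)"
    using a k by (intro mult_strict_left_mono) auto
  also have "\<dots> = 1 / of_int k" using k by (simp add: power2_eq_square)
  finally have e: "\<bar>e\<bar> * of_int k \<le> 1" using k by (simp add: field_simps)
  then have e1: "\<bar>e\<bar> \<le> 1"
    using mult_left_mono[OF k1, of "\<bar>e\<bar>"] by simp
  have "real_of_int (h\<^sup>2 - D * k\<^sup>2) = e * e + 2 * ?s * (e * of_int k)"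
    using ss by (simp add: e_def power2_eq_square algebra_simps)
  then have "\<bar>real_of_int (h\<^sup>2 - D * k\<^sup>2)\<bar> \<le> \<bar>e\<bar> * \<bar>e\<bar> + 2 * ?s * (\<bar>e\<bar> * of_int k)"
    using k s1 by (simp add: abs_mult order.trans[OF abs_triangle_ineq])
  also have "\<dots> \<le> 1 * 1 + 2 * of_int D * 1"
    using e e1 sD s1 k D by (intro add_mono mult_mono) auto
  finally have "real_of_int \<bar>h\<^sup>2 - D * k\<^sup>2\<bar> \<le> of_int (2 * D + 1)" by simp
  then show ?thesis by (simp only: of_int_le_iff)
qed

text \<open>The quotient of \<open>x + y sqrt D\<close> by \<open>z + w sqrt D\<close> has norm 1.
  The congruences modulo the common norm \<open>m\<close> make it integral, and non-proportionality
  makes it irrational.\<close>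

lemma pell_solution_of_congruent_pair:
  fixes D m :: int
  assumes m: "m \<noteq> 0" and n1: "x\<^sup>2 - D * y\<^sup>2 = m" and n2: "z\<^sup>2 - D * w\<^sup>2 = m"
    and cx: "m dvd x - z" and cy: "m dvd y - w" and ne: "x * w \<noteq> y * z"
  shows "\<exists>u t. t \<noteq> 0 \<and> u\<^sup>2 - D * t\<^sup>2 = 1"
proof -
  obtain i j where ij: "x = z + m * i" "y = w + m * j"
    using cx cy by (metis add.commute diff_eq_eq dvdE)
  \<comment> \<open>These are \<open>(x z - D y w) / m\<close> and \<open>(x w - y z) / m\<close>
    after substituting for \<open>x\<close> and \<open>y\<close>; the quotient is
    \<open>u - t sqrt D\<close>.\<close>
  define u t where "u = 1 + i * z - D * j * w" and "t = i * w - j * z"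
  have u: "x * z - D * y * w = m * u"
    using ij n2 unfolding u_def by algebra
  have t: "x * w - y * z = m * t"
    using ij unfolding t_def by algebra
  have "m\<^sup>2 * (u\<^sup>2 - D * t\<^sup>2) = (x\<^sup>2 - D * y\<^sup>2) * (z\<^sup>2 - D * w\<^sup>2)"
    using u t by algebra
  then have "m\<^sup>2 * (u\<^sup>2 - D * t\<^sup>2) = m\<^sup>2 * 1" unfolding n1 n2 by (simp add: power2_eq_square)
  then have "u\<^sup>2 - D * t\<^sup>2 = 1" using m by simp
  moreover have "t \<noteq> 0" using t ne by auto
  ultimately show ?thesis by blast
qed

text \<open>Turns distinctness of two reduced approximations into the non-proportionality that the
  previous lemma asks for.\<close>

lemma coprime_pair_unique:
  fixes x y z w :: int
  assumes "x * w = y * z" "coprime x y" "coprime z w" "y > 0" "w > 0"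
  shows "x = z \<and> y = w"
proof -
  have "y dvd x * w" "w dvd z * y" using assms(1) by (metis dvd_triv_left dvd_triv_right mult.commute)+
  then have "y dvd w" "w dvd y"
    using assms(2,3) by (auto simp: coprime_dvd_mult_right_iff coprime_commute)
  then have "y = w" using assms(4,5) by (simp add: zdvd_antisym_nonneg)
  with assms show ?thesis by simp
qed

text \<open>Two pigeonhole arguments on the infinitely many Dirichlet approximations of
  \<open>sqrt D\<close>: first by norm, then by residues modulo that norm.\<close>

theorem pell_nontrivial_solution:
  fixes D :: int
  assumes D: "D > 0" and nsq: "\<nexists>d. D = d\<^sup>2"
  shows "\<exists>u t. t \<noteq> 0 \<and> u\<^sup>2 - D * t\<^sup>2 = 1"
proof -
  let ?A = "approx_set (sqrt (of_int D))"
  let ?N = "\<lambda>(h, k). h\<^sup>2 - D * k\<^sup>2"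
  have inf: "infinite ?A"
    using sqrt_int_not_rational[OF assms] rational_iff_finite_approx_set by blast
  have "finite (?N ` ?A)"
    by (rule finite_subset[of _ "{- (2 * D + 1)..2 * D + 1}"])
       (use approx_set_sqrt_norm_bound[OF D] in \<open>fastforce simp: abs_le_iff\<close>)+
  from pigeonhole_infinite[OF inf this] obtain p0 where p0: "p0 \<in> ?A"
    and inf2: "infinite {p \<in> ?A. ?N p = ?N p0}" by auto
  define m where "m = ?N p0"
  define B where "B = {p \<in> ?A. ?N p = m}"
  have infB: "infinite B" using inf2 by (simp add: B_def m_def)
  obtain h0 k0 where hk0: "p0 = (h0, k0)" by force
  have "k0 \<noteq> 0" using p0 by (auto simp: hk0 approx_set_def)
  then have m: "m \<noteq> 0"
    using square_int_if_rational_square[of h0 D k0] nsq by (auto simp: m_def hk0)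
  let ?R = "\<lambda>(h, k). (h mod m, k mod m)"
  \<comment> \<open>The norm \<open>m\<close> may be negative and \<open>mod\<close> takes the sign
    of the divisor, hence the symmetric interval.\<close>
  have mod_bound: "x mod m \<in> {- \<bar>m\<bar>..\<bar>m\<bar>}" for x
    using abs_mod_less[OF m, of x] by auto
  have "finite (?R ` B)"
  proof (rule finite_subset)
    show "?R ` B \<subseteq> {- \<bar>m\<bar>..\<bar>m\<bar>} \<times> {- \<bar>m\<bar>..\<bar>m\<bar>}"
      using mod_bound by (auto simp del: atLeastAtMost_iff)
  qed simp
  from pigeonhole_infinite[OF infB this] obtain p1 where "p1 \<in> B"
    and inf3: "infinite {p \<in> B. ?R p = ?R p1}" by auto
  obtain p2 where "p2 \<in> B" "?R p2 = ?R p1" "p2 \<noteq> p1"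
  proof (rule ccontr)
    assume "\<not> thesis"
    then have "{p \<in> B. ?R p = ?R p1} \<subseteq> {p1}" using that by blast
    with inf3 finite_subset show False by blast
  qed
  moreover obtain x y z w where "p1 = (x, y)" "p2 = (z, w)" by force
  ultimately have B: "(x, y) \<in> B" "(z, w) \<in> B" "x mod m = z mod m" "y mod m = w mod m"
    and ne: "(x, y) \<noteq> (z, w)"
    using \<open>p1 \<in> B\<close> by auto
  have "x * w \<noteq> y * z"
    using coprime_pair_unique[of x w y z] B(1,2) ne by (auto simp: B_def approx_set_def)
  with B m show ?thesis
    by (intro pell_solution_of_congruent_pair[of m x D y z w])
       (auto simp: B_def mod_eq_dvd_iff)
qed

section \<open>Irreducible and indefinite forms\<close>

text \<open>Only a splitting into two factors linear in \<open>x\<close> is possible; at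
  \<open>y = 1\<close> it yields a rational root, and completing the square makes the discriminant a
  rational square.\<close>

lemma form_poly_irreducible:
  assumes nsq: "\<nexists>d. b\<^sup>2 - 4 * a * c = d\<^sup>2"
  shows "irreducible (form_poly (a, b, c))"
proof -
  let ?P = "form_poly (a, b, c)"
  have a: "a \<noteq> 0" using nsq by auto
  have deg: "degree ?P = 2" using a by simp
  have lc: "lead_coeff ?P = [:of_int a:]" using a by simp
  \<comment> \<open>Degree 0 in \<open>x\<close> still allows a polynomial in \<open>y\<close>; but
    such a factor divides the leading coefficient, a nonzero constant.\<close>
  have unit: "f dvd 1" if fg: "?P = f * g" and f0: "degree f = 0" for f g
  proof -
    obtain f0 where f: "f = [:f0:]" using f0 by (rule degree_eq_zeroE)
    have "[:of_int a:] = f0 * lead_coeff g"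
      using lc unfolding fg lead_coeff_mult f by simp
    then have "f0 dvd [:of_int a:]" by simp
    then have "f0 dvd 1"
      using a by (metis dvd_trans dvd_field_iff is_unit_const_poly_iff of_int_eq_0_iff one_dvd)
    then show ?thesis by (simp add: f is_unit_const_poly_iff)
  qed
  show ?thesis
  proof (rule irreducibleI)
    show "?P \<noteq> 0" using deg by auto
    show "\<not> ?P dvd 1" using deg by (auto simp: is_unit_poly_iff)
    fix f g assume fg: "?P = f * g"
    then have nz: "f \<noteq> 0" "g \<noteq> 0" using deg by auto
    then have "degree f + degree g = 2" using deg unfolding fg by (simp add: degree_mult_eq)
    then consider "degree f = 0" | "degree g = 0" | "degree f = 1" "degree g = 1" by linarith
    then show "f dvd 1 \<or> g dvd 1"
    proof cases
      case 1 then show ?thesis using unit fg by blast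
    next
      case 2 then show ?thesis using unit[of g f] fg by (simp add: mult.commute)
    next
      case 3
      have "lead_coeff f dvd [:of_int a:]" using lc unfolding fg lead_coeff_mult by (metis dvd_triv_left)
      then have "is_unit (lead_coeff f)"
        using a by (metis dvd_trans dvd_field_iff is_unit_const_poly_iff of_int_eq_0_iff one_dvd)
      then obtain \<alpha> where \<alpha>: "lead_coeff f = [:\<alpha>:]" "\<alpha> \<noteq> 0"
        by (auto simp: is_unit_poly_iff dvd_field_iff)
      obtain f0 f1 where f': "f = [:f0, f1:]"
        using 3 by (metis degree1_coeffs)
      have f: "f = [:f0, [:\<alpha>:]:]" using 3 \<alpha> f' by simp
      define x where "x = - poly f0 1 / \<alpha>"
      have "poly (poly f [:x:]) 1 = 0" using \<alpha> by (simp add: f x_def)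
      then have root: "of_int a * x\<^sup>2 + of_int b * x + of_int c = 0"
        using form_poly_eval[of a b c x 1] unfolding fg by simp
      have sq: "(2 * of_int a * x + of_int b)\<^sup>2 = of_int (b\<^sup>2 - 4 * a * c)"
        using root by simp algebra
      obtain p q where pq: "2 * of_int a * x + of_int b = of_int p / of_int q" "q > 0"
        by (metis quotient_of_div quotient_of_denom_pos surj_pair)
      then have "rat_of_int p = (2 * of_int a * x + of_int b) * of_int q" by simp
      then have "rat_of_int (p\<^sup>2) = (2 * of_int a * x + of_int b)\<^sup>2 * of_int (q\<^sup>2)"
        by (simp add: power_mult_distrib)
      also have "\<dots> = of_int ((b\<^sup>2 - 4 * a * c) * q\<^sup>2)" unfolding sq by simp
      finally have "rat_of_int (p\<^sup>2) = of_int ((b\<^sup>2 - 4 * a * c) * q\<^sup>2)" .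
      then have "p\<^sup>2 = (b\<^sup>2 - 4 * a * c) * q\<^sup>2" by (simp only: of_int_eq_iff)
      with square_int_if_rational_square pq nsq show ?thesis by fastforce
    qed
  qed
qed

text \<open>Explicit factorizations: \<open>y (b x + c y)\<close> if \<open>a = 0\<close>, otherwise
  \<open>a (x + r y) (x + s y)\<close> with rational \<open>r\<close> and \<open>s\<close> from the
  quadratic formula.\<close>

lemma form_poly_reducible:
  assumes sq: "b\<^sup>2 - 4 * a * c = d\<^sup>2"
  shows "\<not> irreducible (form_poly (a, b, c))"
proof (cases "a = 0")
  case True
  then have "form_poly (a, b, c) = [:[:0, 1:]:] * [:[:0, of_int c:], [:of_int b:]:]" by simp
  moreover have "\<not> [:[:0, 1:]:] dvd (1 :: rat poly poly)"
    by (auto simp: is_unit_poly_iff)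
  moreover have "\<not> [:[:0, of_int c:], [:of_int b:]:] dvd (1 :: rat poly poly)"
    by (auto simp: is_unit_poly_iff)
  ultimately show ?thesis using irreducibleD by blast
next
  case False
  define r s where "r = (of_int b - of_int d) / (2 * rat_of_int a)"
    and "s = (of_int b + of_int d) / (2 * rat_of_int a)"
  have "of_int a * (r + s) = of_int b" using False by (simp add: r_def s_def field_simps)
  moreover have "of_int a * (r * s) = of_int c"
  proof -
    have "rat_of_int (b\<^sup>2 - 4 * a * c) = of_int (d\<^sup>2)" using sq by simp
    then have "(of_int b - of_int d) * (of_int b + of_int d) = 4 * rat_of_int a * of_int c"
      by (simp add: power2_eq_square algebra_simps)
    then show ?thesis using False by (simp add: r_def s_def)
  qed
  ultimately have "form_poly (a, b, c) = [:[:0, of_int a * r:], [:of_int a:]:] * [:[:0, s:], 1:]"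
    by (simp add: algebra_simps)
  moreover have "\<not> [:[:0, of_int a * r:], [:of_int a:]:] dvd (1 :: rat poly poly)"
    using False by (auto simp: is_unit_poly_iff)
  moreover have "\<not> [:[:0, s:], 1:] dvd (1 :: rat poly poly)"
    by (auto simp: is_unit_poly_iff)
  ultimately show ?thesis using irreducibleD by blast
qed

text \<open>From \<open>4 a Q = (2 a x + b y)^2 - D y^2\<close>: the point \<open>(- b, 2 a)\<close>
  kills the square and gives \<open>- a D\<close>, opposite in sign to the value \<open>a\<close> at
  \<open>(1, 0)\<close>.\<close>

lemma indefinite_form_if_discr_pos:
  assumes "b\<^sup>2 - 4 * a * c > 0" "a \<noteq> 0"
  shows "indefinite_form (a, b, c)"
proof -
  let ?a = "real_of_int a" and ?D = "real_of_int (b\<^sup>2 - 4 * a * c)"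
  have 1: "form_eval (a, b, c) 1 0 = ?a" by simp
  have 2: "form_eval (a, b, c) (- of_int b) (2 * ?a) = - ?a * ?D"
    by (simp add: power2_eq_square algebra_simps)
  have D: "?D > 0" using assms(1) by (simp only: of_int_0_less_iff)
  show ?thesis
  proof (cases "a > 0")
    case True
    then have "- ?a * ?D < 0" using D by (simp add: mult_neg_pos)
    with True 1 2 show ?thesis unfolding indefinite_form_def by (metis of_int_0_less_iff)
  next
    case False
    then have "?a < 0" using assms(2) by simp
    moreover from this have "- ?a * ?D > 0" using D by (intro mult_pos_pos) auto
    ultimately show ?thesis using 1 2 unfolding indefinite_form_def by metis
  qed
qed

text \<open>If \<open>D \<le> 0\<close>, the same identity shows \<open>a Q \<ge> 0\<close>
  everywhere, so two signs force \<open>a = 0\<close>. Then \<open>D = b^2\<close> forces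
  \<open>b = 0\<close>, and \<open>c y^2\<close> has only one sign.\<close>

lemma discr_pos_if_indefinite_form:
  assumes "indefinite_form (a, b, c)"
  shows "b\<^sup>2 - 4 * a * c > 0"
proof (rule ccontr)
  assume neg: "\<not> ?thesis"
  let ?D = "real_of_int (b\<^sup>2 - 4 * a * c)"
  have D: "?D \<le> 0" using neg by (simp only: of_int_le_0_iff not_less)
  have a: "of_int a * form_eval (a, b, c) x y \<ge> 0" for x y
  proof -
    have "4 * (of_int a * form_eval (a, b, c) x y) = (2 * of_int a * x + of_int b * y)\<^sup>2 - ?D * y\<^sup>2"
      by (simp add: power2_eq_square algebra_simps)
    moreover have "?D * y\<^sup>2 \<le> 0" using D by (simp add: mult_nonpos_nonneg)
    ultimately show ?thesis using zero_le_power2[of "2 * of_int a * x + of_int b * y"] by linarith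
  qed
  obtain x y z w where pos: "form_eval (a, b, c) x y > 0" and nega: "form_eval (a, b, c) z w < 0"
    using assms by (auto simp: indefinite_form_def)
  have "real_of_int a = 0"
    using a[of x y] a[of z w] pos nega by (smt (verit) mult_pos_neg mult_neg_pos)
  then have a0: "a = 0" by simp
  with neg have b0: "b = 0" by simp
  have "0 < of_int c * y\<^sup>2" "of_int c * w\<^sup>2 < 0" using pos nega a0 b0 by simp_all
  then show False by (smt (verit) mult_nonneg_nonneg mult_nonpos_nonneg zero_le_power2)
qed

lemma F_plus_iff:
  "(a, b, c) \<in> F_plus \<longleftrightarrow> gcd a (gcd b c) = 1 \<and> b\<^sup>2 - 4 * a * c > 0 \<and> (\<nexists>d. b\<^sup>2 - 4 * a * c = d\<^sup>2)"
proof (intro iffI conjI)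
  assume "(a, b, c) \<in> F_plus"
  then show "gcd a (gcd b c) = 1" "b\<^sup>2 - 4 * a * c > 0" "\<nexists>d. b\<^sup>2 - 4 * a * c = d\<^sup>2"
    using discr_pos_if_indefinite_form form_poly_reducible
    by (auto simp: F_plus_def forms_def simp del: form_poly.simps)
next
  assume *: "gcd a (gcd b c) = 1 \<and> b\<^sup>2 - 4 * a * c > 0 \<and> (\<nexists>d. b\<^sup>2 - 4 * a * c = d\<^sup>2)"
  moreover from this have "a \<noteq> 0" by auto
  ultimately show "(a, b, c) \<in> F_plus"
    using indefinite_form_if_discr_pos form_poly_irreducible[of b a c]
    by (simp add: F_plus_def forms_def del: form_poly.simps)
qed

section \<open>Centralizers in the integral general linear group\<close>

lemma vec2_eq_iff: "(M :: 'a^2^2) = N \<longleftrightarrow>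
    M$1$1 = N$1$1 \<and> M$1$2 = N$1$2 \<and> M$2$1 = N$2$1 \<and> M$2$2 = N$2$2"
  by (auto simp: vec_eq_iff forall_2)

lemma invertible_int2_iff: "invertible (M :: int^2^2) \<longleftrightarrow> det M = 1 \<or> det M = -1"
proof
  assume "invertible M"
  then obtain N where "M ** N = mat 1" by (auto simp: invertible_def)
  then have "det M * det N = 1" by (metis det_I det_mul)
  then show "det M = 1 \<or> det M = -1" using zmult_eq_1_iff by blast
next
  assume *: "det M = 1 \<or> det M = -1"
  define e where "e = det M"
  have e: "e * e = 1" "e = M$1$1 * M$2$2 - M$1$2 * M$2$1" using * by (auto simp: e_def det_2)
  \<comment> \<open>The adjugate times \<open>e\<close>, which is its own inverse.\<close>
  define N :: "int^2^2" where
    "N = vector [vector [e * M$2$2, - e * M$1$2], vector [- e * M$2$1, e * M$1$1]]"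
  have "e * (M$1$1 * M$2$2 - M$1$2 * M$2$1) = 1" using e by simp
  then have "M ** N = mat 1 \<and> N ** M = mat 1"
    unfolding N_def vec2_eq_iff
    by (simp add: matrix_matrix_mult_def sum_2 mat_def algebra_simps)
  then show "invertible M" by (auto simp: invertible_def)
qed

text \<open>The equations say that the 2 by 2 minors of the coefficient triples of the two attached
  forms vanish.\<close>

lemma commute_iff:
  fixes M N :: "int^2^2"
  shows "M ** N = N ** M \<longleftrightarrow>
    M$2$1 * (N$2$2 - N$1$1) = N$2$1 * (M$2$2 - M$1$1) \<and>
    M$2$1 * N$1$2 = N$2$1 * M$1$2 \<and>
    M$1$2 * (N$2$2 - N$1$1) = N$1$2 * (M$2$2 - M$1$1)"
  unfolding vec2_eq_iff
  by (auto simp: matrix_matrix_mult_def sum_2 algebra_simps)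

text \<open>A matrix whose attached form is exactly \<open>a x\<^sup>2 + b x y + c y\<^sup>2\<close>.\<close>

definition companion :: "int \<times> int \<times> int \<Rightarrow> int^2^2" where
  "companion = (\<lambda>(a, b, c). vector [vector [0, - c], vector [a, b]])"

lemma companion_simps [simp]:
  "companion (a, b, c) $ 1 $ 1 = 0" "companion (a, b, c) $ 1 $ 2 = - c"
  "companion (a, b, c) $ 2 $ 1 = a" "companion (a, b, c) $ 2 $ 2 = b"
  by (simp_all add: companion_def)

text \<open>Multiplying \<open>det(M) M\<^sup>T Q M = Q\<close> on the right by the adjugate of \<open>M\<close> makes the
  equation linear in \<open>M\<close>.\<close>

lemma S_group_eq_centralizer:
  "S_group Q = {M. invertible M \<and> M ** companion Q = companion Q ** M}"
proof -
  obtain a b c where Q: "Q = (a, b, c)" by (cases Q)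
  have "(real_of_int (det M) *\<^sub>R
       (transpose (map_matrix real_of_int M) ** form_matrix Q ** map_matrix real_of_int M)
     = form_matrix Q) \<longleftrightarrow> M ** companion Q = companion Q ** M" (is "?L \<longleftrightarrow> ?R")
    if "invertible M" for M
  proof -
    define p q r s where "p = M$1$1" and "q = M$1$2" and "r = M$2$1" and "s = M$2$2"
    note M = p_def[symmetric] q_def[symmetric] r_def[symmetric] s_def[symmetric]
    have det: "det M = p * s - q * r" by (simp add: det_2 M)
    have d: "(p * s - q * r) * (p * s - q * r) = 1"
      using that det by (auto simp: invertible_int2_iff)
    have swap: "(p * s - q * r) * x = y \<longleftrightarrow> x = (p * s - q * r) * y" for x y
      using d by (metis mult.assoc mult_1)
    have "?L \<longleftrightarrow>
        real_of_int ((p * s - q * r) * (a * p\<^sup>2 + b * p * r + c * r\<^sup>2)) = of_int a \<and>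
        real_of_int ((p * s - q * r) * (2 * a * p * q + b * (p * s + q * r) + 2 * c * r * s)) = of_int b \<and>
        real_of_int ((p * s - q * r) * (a * q\<^sup>2 + b * q * s + c * s\<^sup>2)) = of_int c"
      unfolding Q vec2_eq_iff det
      by (simp add: matrix_matrix_mult_def sum_2 transpose_def M power2_eq_square)
         (auto simp: field_simps)
    also have "\<dots> \<longleftrightarrow>
        (p * s - q * r) * (a * p\<^sup>2 + b * p * r + c * r\<^sup>2) = a \<and>
        (p * s - q * r) * (2 * a * p * q + b * (p * s + q * r) + 2 * c * r * s) = b \<and>
        (p * s - q * r) * (a * q\<^sup>2 + b * q * s + c * s\<^sup>2) = c"
      by (simp only: of_int_eq_iff)
    also have "\<dots> \<longleftrightarrow>
        a * p\<^sup>2 + b * p * r + c * r\<^sup>2 = (p * s - q * r) * a \<and>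
        2 * a * p * q + b * (p * s + q * r) + 2 * c * r * s = (p * s - q * r) * b \<and>
        a * q\<^sup>2 + b * q * s + c * s\<^sup>2 = (p * s - q * r) * c"
      using swap by metis
    also have "\<dots> \<longleftrightarrow> r * b = a * (s - p) \<and> r * c = - (a * q) \<and> q * b = - (c * (s - p))"
      (is "?E \<longleftrightarrow> ?F")
    proof
      assume ?E
      then have E: "a * p\<^sup>2 + b * p * r + c * r\<^sup>2 = (p * s - q * r) * a"
        "2 * a * p * q + b * (p * s + q * r) + 2 * c * r * s = (p * s - q * r) * b"
        "a * q\<^sup>2 + b * q * s + c * s\<^sup>2 = (p * s - q * r) * c" by auto
      \<comment> \<open>The linear equations appear multiplied by the determinant, from clearing the
        inverse of \<open>M\<close>, and by 2, from the half in the off-diagonal entry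
        \<open>b / 2\<close>. This factor is nonzero and cancels.\<close>
      have "2 * (p * s - q * r) * (r * b) = 2 * (p * s - q * r) * (a * (s - p))"
        using E(1,2) by algebra
      moreover have "2 * (p * s - q * r) * (r * c) = 2 * (p * s - q * r) * (- (a * q))"
        using E(1,2) by algebra
      moreover have "2 * (p * s - q * r) * (q * b) = 2 * (p * s - q * r) * (- (c * (s - p)))"
        using E(2,3) by algebra
      moreover have "2 * (p * s - q * r) \<noteq> 0" using d by auto
      ultimately show ?F unfolding mult_cancel_left by blast
    next
      assume ?F
      then have F: "r * b = a * (s - p)" "r * c = - (a * q)" "q * b = - (c * (s - p))" by auto
      have "a * p\<^sup>2 + b * p * r + c * r\<^sup>2 = (p * s - q * r) * a" using F(1,2) by algebra
      moreover have "2 * a * p * q + b * (p * s + q * r) + 2 * c * r * s = (p * s - q * r) * b"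
        using F(1,2) by algebra
      moreover have "a * q\<^sup>2 + b * q * s + c * s\<^sup>2 = (p * s - q * r) * c" using F(2,3) by algebra
      ultimately show ?E by blast
    qed
    also have "\<dots> \<longleftrightarrow> ?R"
      unfolding Q commute_iff by (auto simp: M algebra_simps)
    finally show ?thesis .
  qed
  then show ?thesis by (auto simp: S_group_def GL2Z_def)
qed

section \<open>The groups S(Q) as abelian subgroups\<close>

lemma subgroup_S_group: "subgroup (S_group Q) GL2Z"
proof (rule group.subgroupI[OF group_GL2Z])
  show "S_group Q \<subseteq> carrier GL2Z" by (auto simp: S_group_def)
  have "mat 1 \<in> S_group Q" by (auto simp: S_group_eq_centralizer invertible_def)
  then show "S_group Q \<noteq> {}" by blast
next
  fix M assume M: "M \<in> S_group Q"
  let ?N = "inv\<^bsub>GL2Z\<^esub> M" and ?A = "companion Q"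
  have Mc: "M \<in> carrier GL2Z" using M by (simp add: S_group_def)
  have N: "?N \<in> carrier GL2Z" "?N ** M = mat 1" "M ** ?N = mat 1"
    using group.inv_closed[OF group_GL2Z Mc] group.l_inv[OF group_GL2Z Mc]
      group.r_inv[OF group_GL2Z Mc] by (simp_all add: GL2Z_def)
  have "M ** ?A = ?A ** M" using M by (simp add: S_group_eq_centralizer)
  then have "(?N ** M) ** ?A ** ?N = ?N ** ?A ** (M ** ?N)"
    by (simp flip: matrix_mul_assoc)
  then have "?N ** ?A = ?A ** ?N" by (simp add: N)
  then show "?N \<in> S_group Q" using N(1) by (simp add: S_group_eq_centralizer GL2Z_def)
next
  fix M N assume MN: "M \<in> S_group Q" "N \<in> S_group Q"
  let ?A = "companion Q"
  have "M ** N ** ?A = M ** (?A ** N)"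
    using MN by (simp add: S_group_eq_centralizer flip: matrix_mul_assoc)
  also have "\<dots> = ?A ** (M ** N)"
    using MN by (simp add: S_group_eq_centralizer matrix_mul_assoc)
  finally show "M \<otimes>\<^bsub>GL2Z\<^esub> N \<in> S_group Q"
    using MN by (simp add: S_group_eq_centralizer GL2Z_def invertible_mult)
qed

lemma comm_group_GL2Z_iff:
  assumes "subgroup H GL2Z"
  shows "comm_group (GL2Z\<lparr>carrier := H\<rparr>) \<longleftrightarrow> (\<forall>M\<in>H. \<forall>N\<in>H. M ** N = N ** M)"
proof
  assume "comm_group (GL2Z\<lparr>carrier := H\<rparr>)"
  then interpret comm_group "GL2Z\<lparr>carrier := H\<rparr>" .
  show "\<forall>M\<in>H. \<forall>N\<in>H. M ** N = N ** M" using m_comm by (simp add: GL2Z_def)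
next
  assume "\<forall>M\<in>H. \<forall>N\<in>H. M ** N = N ** M"
  then show "comm_group (GL2Z\<lparr>carrier := H\<rparr>)"
    using subgroup.subgroup_is_group[OF assms group_GL2Z]
    by (intro group.group_comm_groupI) (auto simp: GL2Z_def)
qed

lemma maximal_abelian_GL2Z_iff:
  "maximal_abelian_subgroup H GL2Z \<longleftrightarrow> subgroup H GL2Z \<and> (\<forall>M\<in>H. \<forall>N\<in>H. M ** N = N ** M) \<and>
    (\<forall>K. subgroup K GL2Z \<longrightarrow> (\<forall>M\<in>K. \<forall>N\<in>K. M ** N = N ** M) \<longrightarrow> H \<subseteq> K \<longrightarrow> K = H)"
  unfolding maximal_abelian_subgroup_def using comm_group_GL2Z_iff by blast

text \<open>Both attached forms are proportional to \<open>Q\<close>, hence to each other. For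
  \<open>Q = 0\<close> this fails, as \<open>S_group Q\<close> is then the whole group.\<close>

lemma S_group_commute:
  assumes Q: "Q \<noteq> (0, 0, 0)" and MN: "M \<in> S_group Q" "N \<in> S_group Q"
  shows "M ** N = N ** M"
proof -
  obtain a b c where abc: "Q = (a, b, c)" by (cases Q)
  have M: "M$2$1 * b = a * (M$2$2 - M$1$1)" "- (M$2$1 * c) = a * M$1$2"
      "M$1$2 * b = - (c * (M$2$2 - M$1$1))"
    and N: "N$2$1 * b = a * (N$2$2 - N$1$1)" "- (N$2$1 * c) = a * N$1$2"
      "N$1$2 * b = - (c * (N$2$2 - N$1$1))"
    using MN by (auto simp: S_group_eq_centralizer commute_iff abc)
  consider "a \<noteq> 0" | "b \<noteq> 0" | "c \<noteq> 0" using Q abc by auto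
  then show ?thesis
  proof cases
    case 1
    \<comment> \<open>In each case the minor that omits the position of the nonzero coefficient
      needs that coefficient squared.\<close>
    have "a * (M$2$1 * (N$2$2 - N$1$1)) = a * (N$2$1 * (M$2$2 - M$1$1))"
      "a * (M$2$1 * N$1$2) = a * (N$2$1 * M$1$2)"
      "a * (a * (M$1$2 * (N$2$2 - N$1$1))) = a * (a * (N$1$2 * (M$2$2 - M$1$1)))"
      using M N by algebra+
    with 1 show ?thesis by (simp add: commute_iff)
  next
    case 2
    have "b * (M$2$1 * (N$2$2 - N$1$1)) = b * (N$2$1 * (M$2$2 - M$1$1))"
      "b * (b * (M$2$1 * N$1$2)) = b * (b * (N$2$1 * M$1$2))"
      "b * (M$1$2 * (N$2$2 - N$1$1)) = b * (N$1$2 * (M$2$2 - M$1$1))"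
      using M N by algebra+
    with 2 show ?thesis by (simp add: commute_iff)
  next
    case 3
    have "c * (c * (M$2$1 * (N$2$2 - N$1$1))) = c * (c * (N$2$1 * (M$2$2 - M$1$1)))"
      "c * (M$2$1 * N$1$2) = c * (N$2$1 * M$1$2)"
      "c * (M$1$2 * (N$2$2 - N$1$1)) = c * (N$1$2 * (M$2$2 - M$1$1))"
      using M N by algebra+
    with 3 show ?thesis by (simp add: commute_iff)
  qed
qed

section \<open>Maximality among abelian subgroups\<close>

lemma maximal_abelian_eq_S_group:
  assumes "maximal_abelian_subgroup H GL2Z" "Q \<noteq> (0, 0, 0)" "H \<subseteq> S_group Q"
  shows "H = S_group Q"
  using assms subgroup_S_group[of Q] S_group_commute[of Q]
  unfolding maximal_abelian_GL2Z_iff by blast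

text \<open>\<open>M\<close> has attached form \<open>t (a, b, c)\<close>, the companion matrix has
  \<open>(a, b, c)\<close>; a nonzero scalar does not affect proportionality, so both have the same
  centralizer.\<close>

lemma commute_companion_iff:
  fixes M N :: "int^2^2"
  assumes "t \<noteq> 0" "M$2$1 = t * a" "M$2$2 - M$1$1 = t * b" "M$1$2 = - (t * c)"
  shows "N ** M = M ** N \<longleftrightarrow> N ** companion (a, b, c) = companion (a, b, c) ** N"
proof -
  have "N ** M = M ** N \<longleftrightarrow>
      t * (N$2$1 * b) = t * (a * (N$2$2 - N$1$1)) \<and>
      t * (- (N$2$1 * c)) = t * (a * N$1$2) \<and>
      t * (N$1$2 * b) = t * (- (c * (N$2$2 - N$1$1)))"
    unfolding commute_iff assms(2-4) by (simp add: mult.left_commute[of _ t] mult.assoc)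
  also have "\<dots> \<longleftrightarrow> N ** companion (a, b, c) = companion (a, b, c) ** N"
    unfolding commute_iff mult_cancel_left using assms(1) by simp
  finally show ?thesis .
qed

text \<open>The solution yields a non-scalar unit \<open>M\<close> in
  \<open>S_group (a, b, c)\<close>. An abelian group containing it lies in the centralizer of
  \<open>M\<close>, which cuts out exactly \<open>S_group (a, b, c)\<close>.\<close>

lemma maximal_abelian_S_group:
  assumes Q: "(a, b, c) \<noteq> (0, 0, 0)" and t: "t \<noteq> 0"
    and pell: "\<bar>u\<^sup>2 - (b\<^sup>2 - 4 * a * c) * t\<^sup>2\<bar> = 4"
  shows "maximal_abelian_subgroup (S_group (a, b, c)) GL2Z"
proof -
  have "even (u\<^sup>2 - (b\<^sup>2 - 4 * a * c) * t\<^sup>2)"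
    using pell by (metis dvd_abs_iff even_numeral)
  \<comment> \<open>The discriminant has the parity of \<open>b\<close>, so \<open>u\<close> has
    that of \<open>t b\<close> and the diagonal entries \<open>(u - t b) / 2\<close> and
    \<open>(u + t b) / 2\<close> of \<open>M\<close> are integers.\<close>
  then have "even (u - t * b)" by (auto simp: algebra_simps)
  then obtain p where p: "u - t * b = 2 * p" ..
  define M :: "int^2^2" where "M = vector [vector [p, - (t * c)], vector [t * a, p + t * b]]"
  have M: "M$2$1 = t * a" "M$2$2 - M$1$1 = t * b" "M$1$2 = - (t * c)" by (simp_all add: M_def)
  have "4 * det M = u\<^sup>2 - (b\<^sup>2 - 4 * a * c) * t\<^sup>2"
    using p by (simp add: M_def det_2) algebra
  then have "invertible M" using pell by (auto simp: invertible_int2_iff)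
  then have MS: "M \<in> S_group (a, b, c)"
    using commute_companion_iff[OF t M, of M] by (simp add: S_group_eq_centralizer)
  have "K = S_group (a, b, c)"
    if K: "subgroup K GL2Z" "\<forall>M\<in>K. \<forall>N\<in>K. M ** N = N ** M" "S_group (a, b, c) \<subseteq> K" for K
  proof -
    have "K \<subseteq> S_group (a, b, c)"
    proof
      fix N assume N: "N \<in> K"
      then have "N ** M = M ** N" using K(2,3) MS by blast
      then have "N ** companion (a, b, c) = companion (a, b, c) ** N"
        by (simp add: commute_companion_iff[OF t M])
      with N subgroup.subset[OF K(1)] show "N \<in> S_group (a, b, c)"
        by (auto simp: S_group_eq_centralizer GL2Z_def)
    qed
    with K(3) show ?thesis by blast
  qed
  then show ?thesis
    unfolding maximal_abelian_GL2Z_iff using subgroup_S_group S_group_commute[OF Q] by blast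
qed

section \<open>The discriminants that occur\<close>

text \<open>A negative \<open>D\<close> is at least -4 by size, and a discriminant is 0 or 1 modulo
  4. If \<open>D = d^2 > 0\<close>, then \<open>u^2\<close> and \<open>(d t)^2\<close> differ by 4,
  so \<open>d\<close> divides 2.\<close>

lemma discr_cases:
  fixes D t u b ac :: int
  assumes pell: "\<bar>u\<^sup>2 - D * t\<^sup>2\<bar> = 4" and t: "t \<noteq> 0" and D: "D = b\<^sup>2 - 4 * ac"
  shows "D \<in> {-4, -3, 0, 1, 4} \<or> (D > 0 \<and> (\<nexists>d. D = d\<^sup>2))"
proof -
  have t1: "t\<^sup>2 \<ge> 1" using t by (simp add: int_one_le_iff_zero_less)
  consider "D < 0" | "D = 0" | "D > 0" "\<nexists>d. D = d\<^sup>2" | d where "D > 0" "D = d\<^sup>2" by force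
  then show ?thesis
  proof cases
    case 1
    have "- D * 1 \<le> - D * t\<^sup>2" using 1 t1 by (intro mult_left_mono) auto
    moreover have "u\<^sup>2 \<ge> 0" by simp
    ultimately have "D \<ge> -4" using pell by linarith
    moreover have "b\<^sup>2 mod 4 = 0 \<or> b\<^sup>2 mod 4 = 1"
    proof (cases "even b")
      case False
      then obtain k where "b = 2 * k + 1" by (rule oddE)
      then have "b\<^sup>2 = 4 * (k * k + k) + 1" by (simp add: power2_eq_square algebra_simps)
      then show ?thesis by presburger
    qed (auto elim!: evenE simp: power2_eq_square)
    then have "D mod 4 = 0 \<or> D mod 4 = 1" unfolding D by presburger
    ultimately show ?thesis using 1 by (auto; presburger)
  next
    case 4
    define x where "x = \<bar>d * t\<bar>"
    define y where "y = \<bar>u\<bar>"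
    have x: "x > 0" using 4 t by (auto simp: x_def)
    have eq: "\<bar>y * y - x * x\<bar> = 4"
      using pell 4 by (simp add: x_def y_def power2_eq_square algebra_simps)
    have y0: "y \<ge> 0" by (simp add: y_def)
    \<comment> \<open>The only two squares at distance 4 are 0 and 4.\<close>
    have "x = 2"
    proof -
      have "\<bar>y - x\<bar> * (y + x) = 4"
      proof -
        have "\<bar>y - x\<bar> * (y + x) = \<bar>(y - x) * (y + x)\<bar>" using x y0 by (simp add: abs_mult)
        also have "(y - x) * (y + x) = y * y - x * x" by (simp add: algebra_simps)
        finally show ?thesis using eq by simp
      qed
      then have *: "(y + x) dvd 4" "\<bar>y - x\<bar> * (y + x) = 4" by (metis dvd_triv_right)+
      then have "y + x \<le> 4" by (simp add: zdvd_imp_le)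
      then have "x \<in> {1, 2, 3, 4}" "y \<in> {0, 1, 2, 3}" using x y0 by auto
      with eq show ?thesis by auto
    qed
    then have "\<bar>d\<bar> * \<bar>t\<bar> = 2" by (simp add: x_def abs_mult)
    then have "\<bar>d\<bar> dvd 2" by (metis dvd_triv_left)
    then have "\<bar>d\<bar> \<le> 2" by (simp add: zdvd_imp_le)
    moreover have "d \<noteq> 0" using 4 by auto
    ultimately have "d \<in> {-2, -1, 1, 2}" by auto
    with 4 show ?thesis by auto
  qed auto
qed

lemma primitive_multiple:
  fixes x y z :: int
  assumes "(x, y, z) \<noteq> (0, 0, 0)"
  obtains g a b c where "g \<noteq> 0" "gcd a (gcd b c) = 1" "x = g * a" "y = g * b" "z = g * c"
proof -
  define g where "g = gcd x (gcd y z)"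
  have g: "g > 0" using assms by (auto simp: g_def)
  have "g dvd x" "g dvd y" "g dvd z" by (auto simp: g_def intro: dvd_trans)
  then obtain a b c where abc: "x = g * a" "y = g * b" "z = g * c" by (metis dvdE)
  have "gcd x (gcd y z) = gcd (g * a) (gcd (g * b) (g * c))" by (simp only: abc)
  also have "\<dots> = g * gcd a (gcd b c)"
    using g gcd_mult_distrib_int[of g a "gcd b c"] gcd_mult_distrib_int[of g b c] by simp
  finally have "g * gcd a (gcd b c) = g" by (simp flip: g_def)
  with g have "gcd a (gcd b c) = 1" by simp
  with g abc that show thesis by (metis less_irrefl)
qed

theorem theorem4p44:
  fixes \<G> :: "(int^2^2) set"
  assumes "subgroup \<G> GL2Z"
  shows "maximal_abelian_subgroup \<G> GL2Z \<longleftrightarrow> (\<exists>Q \<in> F_plus \<union> F_minus. \<G> = S_group Q)"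
proof
  assume max: "maximal_abelian_subgroup \<G> GL2Z"
  then have comm: "M ** N = N ** M" if "M \<in> \<G>" "N \<in> \<G>" for M N
    using that by (auto simp: maximal_abelian_GL2Z_iff)
  have inv: "invertible M" if "M \<in> \<G>" for M
    using subgroup.subset[OF assms] that by (auto simp: GL2Z_def)
  show "\<exists>Q \<in> F_plus \<union> F_minus. \<G> = S_group Q"
  proof (cases "\<exists>M\<in>\<G>. (M$2$1, M$2$2 - M$1$1, - M$1$2) \<noteq> (0, 0, 0)")
    case True
    then obtain M where M: "M \<in> \<G>" "(M$2$1, M$2$2 - M$1$1, - M$1$2) \<noteq> (0, 0, 0)" by blast
    obtain g a b c where g: "g \<noteq> 0" and prim: "gcd a (gcd b c) = 1"
      and eqs: "M$2$1 = g * a" "M$2$2 - M$1$1 = g * b" "- M$1$2 = g * c"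
      using primitive_multiple[OF M(2)] by metis
    then have eq12: "M$1$2 = - (g * c)" by linarith
    have Q: "(a, b, c) \<noteq> (0, 0, 0)" using prim by auto
    have "\<G> \<subseteq> S_group (a, b, c)"
      using commute_companion_iff[OF g eqs(1,2) eq12] comm[OF _ M(1)] inv
      by (auto simp: S_group_eq_centralizer)
    then have G: "\<G> = S_group (a, b, c)" by (rule maximal_abelian_eq_S_group[OF max Q])
    \<comment> \<open>The subtracted term is \<open>(M$2$2 - M$1$1)^2 + 4 M$1$2 M$2$1\<close>, the
      discriminant of the characteristic polynomial; so the trace and \<open>g\<close> solve the
      equation.\<close>
    have "(M$1$1 + M$2$2)\<^sup>2 - (b\<^sup>2 - 4 * a * c) * g\<^sup>2 = 4 * det M"
      using eqs(1,2) eq12 unfolding det_2 by algebra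
    then have "\<bar>(M$1$1 + M$2$2)\<^sup>2 - (b\<^sup>2 - 4 * (a * c)) * g\<^sup>2\<bar> = 4"
      using inv[OF M(1)] by (auto simp: invertible_int2_iff mult.assoc)
    from discr_cases[OF this g refl] have "(a, b, c) \<in> F_plus \<union> F_minus"
      using prim by (auto simp: F_plus_iff F_minus_def forms_def mult.assoc)
    with G show ?thesis by blast
  next
    case False
    \<comment> \<open>Scalar matrices lie in every \<open>S_group Q\<close>; the form
      \<open>y^2\<close> of discriminant 0 is one admissible choice.\<close>
    then have "\<G> \<subseteq> S_group (0, 0, 1)"
      using inv by (auto simp: S_group_eq_centralizer commute_iff)
    then have "\<G> = S_group (0, 0, 1)" by (intro maximal_abelian_eq_S_group[OF max]) auto
    moreover have "(0, 0, 1) \<in> F_minus" by (simp add: F_minus_def forms_def)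
    ultimately show ?thesis by blast
  qed
next
  assume "\<exists>Q \<in> F_plus \<union> F_minus. \<G> = S_group Q"
  then obtain a b c where Q: "(a, b, c) \<in> F_plus \<union> F_minus" and G: "\<G> = S_group (a, b, c)"
    by (metis prod_cases3)
  let ?D = "b\<^sup>2 - 4 * a * c"
  have prim: "gcd a (gcd b c) = 1" using Q by (auto simp: F_plus_def F_minus_def forms_def)
  have "\<exists>u t. t \<noteq> 0 \<and> \<bar>u\<^sup>2 - ?D * t\<^sup>2\<bar> = 4"
  proof (cases "(a, b, c) \<in> F_plus")
    case True
    then obtain u t where ut: "t \<noteq> 0" "u\<^sup>2 - ?D * t\<^sup>2 = 1"
      using pell_nontrivial_solution[of ?D] unfolding F_plus_iff by blast
    \<comment> \<open>Doubling a solution of norm 1 gives one of norm 4.\<close>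
    have "(2 * u)\<^sup>2 - ?D * (2 * t)\<^sup>2 = 4" using ut(2) by algebra
    with ut(1) show ?thesis by (metis abs_numeral mult_eq_0_iff zero_neq_numeral)
  next
    case False
    with Q have "?D \<in> {-4, -3, 0, 1, 4}" by (auto simp: F_minus_def)
    then consider "?D = -4" | "?D = -3" | "?D = 0" | "?D = 1" | "?D = 4" by blast
    then show ?thesis
    \<comment> \<open>For the discriminants 1 and 4 the witnesses have norm -4, so the unit they
      produce has determinant -1.\<close>
    proof cases
      case 1 then show ?thesis by (intro exI[of _ 0] exI[of _ 1]) simp
    next
      case 2 then show ?thesis by (intro exI[of _ 1] exI[of _ 1]) simp
    next
      case 3 then show ?thesis by (intro exI[of _ 2] exI[of _ 1]) simp
    next
      case 4 then show ?thesis by (intro exI[of _ 0] exI[of _ 2]) simp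
    next
      case 5 then show ?thesis by (intro exI[of _ 0] exI[of _ 1]) simp
    qed
  qed
  moreover have "(a, b, c) \<noteq> (0, 0, 0)" using prim by auto
  ultimately show "maximal_abelian_subgroup \<G> GL2Z"
    unfolding G using maximal_abelian_S_group by blast
qed

end
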